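(* Let $n\ge 1$, let $F\subset\mathbb{R}^n$ be non-empty and bounded, and define $$K_F=\bigcap_{a\in\mathcal K_n}\{\alpha\in[0,\infty)^n:\ \alpha\cdot a\le\underline\rho_F(a)\}.$$ Then $$\underline{\mathrm P}(F)\subseteq K_F,\qquad \theta K_F\subseteq\underline{\mathrm P}(F)\quad\text{for every }0\le\theta<1.$$ Consequently $\overline{\underline{\mathrm P}(F)}=K_F$, where the outer bar denotes topological closure.
   Context: An open box in $\mathbb{R}^n$ is an open rectangular box with positive side lengths and arbitrary orientation; its side lengths in decreasing order are $l_1(B)\ge\cdots\ge l_n(B)>0$. Let $\Delta_n=\{\delta\in(0,1)^n:\delta_1\ge\cdots\ge\delta_n\}$. For non-empty bounded $F\subset\mathbb{R}^n$ and $\delta\in\Delta_n$, $N(F;\delta)$ is the least number of open boxes $B$ needed to cover $F$, subject to $l_i(B)\le\delta_i$ for $1\le i\le n$ for every box in the cover (boxes may have different orientations). For $\alpha\in[0,\infty)^n$ write $\delta^\alpha=\prod_i\delta_i^{\alpha_i}$. The lower box dimension print is $$\underline{\mathrm P}(F)=\Bigl\{\alpha\in[0,\infty)^n:\ \liminf_{\delta\in\Delta_n,\ \delta_1\downarrow0}N(F;\delta)\delta^\alpha>0\Bigr\},$$ the lower limit being over all of $\Delta_n$ as $\delta_1\downarrow0$, with no restriction on aspect ratios. Let $\mathcal K_n=\{a\in(0,\infty)^n:a_1\le\cdots\le a_n\}$. For $a\in\mathcal K_n$ and $t>0$ let $e^{-ta}=(e^{-ta_1},\dots,e^{-ta_n})\in\Delta_n$.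 The lower eccentricity profile is $\underline\rho_F(a)=\liminf_{t\to\infty}\frac1t\log N(F;e^{-ta})$. *)

theory Defs
  imports "HOL-Analysis.Analysis"
begin

text \<open>
  The coordinates of \<open>\<real>\<^sup>n\<close> are indexed by a type of sorts \<open>finite\<close> and \<open>linorder\<close>, which is
  order-isomorphic to \<open>{1, \<dots>, n}\<close> for exactly one \<open>n \<ge> 1\<close>; its order gives meaning to
  \<open>\<delta>\<^sub>1 \<ge> \<dots> \<ge> \<delta>\<^sub>n\<close>.
\<close>

definition first_index :: "'n::{finite,linorder}" where
  "first_index = Min UNIV"

definition scale_vectors :: "(real ^ 'n::{finite,linorder}) set"  ("\<Delta>") where
  "\<Delta> = {\<delta>. (\<forall>i. 0 < \<delta> $ i \<and> \<delta> $ i < 1) \<and> (\<forall>i j. i \<le> j \<longrightarrow> \<delta> $ j \<le> \<delta> $ i)}"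

definition exponent_cone :: "(real ^ 'n::{finite,linorder}) set"  ("\<K>") where
  "\<K> = {a. (\<forall>i. 0 < a $ i) \<and> (\<forall>i j. i \<le> j \<longrightarrow> a $ i \<le> a $ j)}"

definition nonneg_orthant :: "(real ^ 'n::finite) set" where
  "nonneg_orthant = {\<alpha>. \<forall>i. 0 \<le> \<alpha> $ i}"

text \<open>
  \<open>open_box_with_sides B l\<close>: \<open>B\<close> is an open rectangular box of arbitrary orientation, and \<open>l\<close>
  lists its side lengths \<open>l\<^sub>1(B) \<ge> \<dots> \<ge> l\<^sub>n(B) > 0\<close>. Sorting the side lengths loses no
  orientations, since permuting coordinates is an orthogonal transformation.
\<close>
definition open_box_with_sides ::
  "(real, 'n::{finite,linorder}) vec set \<Rightarrow> (real, 'n) vec \<Rightarrow> bool" where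
  "open_box_with_sides B l \<longleftrightarrow>
     (\<forall>i. 0 < l $ i) \<and> (\<forall>i j. i \<le> j \<longrightarrow> l $ j \<le> l $ i) \<and>
     (\<exists>c f. orthogonal_transformation f \<and> B = (\<lambda>x. c + f x) ` box 0 l)"

definition box_cover ::
  "(real, 'n::{finite,linorder}) vec set \<Rightarrow> (real, 'n) vec \<Rightarrow> (real, 'n) vec set set \<Rightarrow> bool" where
  "box_cover F \<delta> C \<longleftrightarrow>
     F \<subseteq> \<Union>C \<and> (\<forall>B\<in>C. \<exists>l. open_box_with_sides B l \<and> (\<forall>i. l $ i \<le> \<delta> $ i))"

text \<open>The minimum exists for bounded \<open>F\<close> and positive \<open>\<delta>\<close>; otherwise the value may be junk.\<close>
definition box_number :: "(real, 'n::{finite,linorder}) vec set \<Rightarrow> (real, 'n) vec \<Rightarrow> nat" where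
  "box_number F \<delta> = (LEAST k. \<exists>C. finite C \<and> card C = k \<and> box_cover F \<delta> C)"

definition vec_powr :: "(real, 'n::finite) vec \<Rightarrow> (real, 'n) vec \<Rightarrow> real" where
  "vec_powr \<delta> \<alpha> = (\<Prod>i\<in>UNIV. (\<delta> $ i) powr (\<alpha> $ i))"

text \<open>The filter for \<open>\<delta> \<in> \<Delta>\<close>, \<open>\<delta>\<^sub>1 \<down> 0\<close>, with no restriction on the other coordinates.\<close>
definition small_scales :: "(real ^ 'n::{finite,linorder}) filter" where
  "small_scales =
     inf (filtercomap (\<lambda>\<delta>. \<delta> $ first_index) (at_right 0)) (principal \<Delta>)"

definition lower_print :: "(real, 'n::{finite,linorder}) vec set \<Rightarrow> (real, 'n) vec set" where
  "lower_print F =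
     {\<alpha> \<in> nonneg_orthant.
        Liminf small_scales (\<lambda>\<delta>. ereal (real (box_number F \<delta>) * vec_powr \<delta> \<alpha>)) > 0}"

definition exp_scale :: "real \<Rightarrow> (real, 'n::finite) vec \<Rightarrow> (real, 'n) vec" where
  "exp_scale t a = (\<chi> i. exp (- t * a $ i))"

definition lower_ecc_profile ::
  "(real, 'n::{finite,linorder}) vec set \<Rightarrow> (real, 'n) vec \<Rightarrow> ereal" where
  "lower_ecc_profile F a =
     Liminf at_top (\<lambda>t::real. ereal (1 / t * ln (real (box_number F (exp_scale t a)))))"

definition profile_body :: "(real, 'n::{finite,linorder}) vec set \<Rightarrow> (real, 'n) vec set" where
  "profile_body F =
     (\<Inter>a\<in>\<K>. {\<alpha> \<in> nonneg_orthant. ereal (\<alpha> \<bullet> a) \<le> lower_ecc_profile F a})"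

end

theory Submission
  imports Defs
begin

text \<open>
  Write \<open>\<delta> = e\<^sup>-\<^sup>u\<close> and \<open>g(u) = log N(F; e\<^sup>-\<^sup>u)\<close>. Membership of \<open>\<alpha>\<close> in the print says that
  \<open>g(u) \<ge> \<alpha> \<bullet> u - O(1)\<close> for all increasing \<open>u\<close> with \<open>u\<^sub>1\<close> large, while membership in the profile
  body says that \<open>g(ta) \<ge> t(\<alpha> \<bullet> a) - o(t)\<close> along each single ray. The print is therefore contained
  in the body, and the point of the converse is to gain uniformity over all rays, including
  those whose directions leave every compact part of the open cone of exponents.

  Two facts give this uniformity. The function \<open>g\<close> is monotone, and it is
  Lipschitz up to an additive constant: cutting each box into smaller ones shows
  \<open>g(u') \<le> g(u) + \<Sum>\<^sub>i (u'\<^sub>i - u\<^sub>i)\<^sup>+ + O(1)\<close> (\<open>box_number_subdivide\<close>). Let \<open>m\<close> be the last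
  index with \<open>\<alpha>\<^sub>m > 0\<close>. Enlarging the scales beyond the \<open>m\<close>-th to \<open>\<delta>\<^sub>m\<close> only decreases \<open>N\<close> and does
  not change \<open>\<delta>\<^sup>\<alpha>\<close>, so \<open>u\<close> may be taken constant from \<open>m\<close> on. Then \<open>u = t b\<close> with
  \<open>t = u\<^sub>m\<close> where \<open>b\<^sub>m = 1\<close> and \<open>b\<close> lies in the compact set of increasing vectors in \<open>[0,1]\<^sup>n\<close>.
  Some of these \<open>b\<close> have zero entries, but each is \<open>\<epsilon>\<close>-close to the open cone, so finitely many
  rays inside the cone approximate all of them. The Lipschitz bound transfers the ray
  estimates with an error \<open>O(\<epsilon> t)\<close>, and this is absorbed by
  the gain \<open>(1 - \<theta>) t (\<alpha> \<bullet> b) \<ge> (1 - \<theta>) t \<alpha>\<^sub>m\<close> that comes from replacing \<open>\<alpha>\<close> by \<open>\<theta> \<alpha>\<close>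
  (\<open>profile_body_uniform_bound\<close>).

  The statement on closures follows, because the profile body is closed and
  \<open>\<theta> \<alpha> \<rightarrow> \<alpha>\<close> as \<open>\<theta> \<up> 1\<close>.
\<close>

section \<open>Covering numbers\<close>

text \<open>
  The pieces are translates of one box with sides \<open>min l\<^sub>i \<delta>'\<^sub>i\<close>, which is again a decreasing
  list. Being open they have to overlap, so they are placed at multiples of half their side lengths;
  this costs the factor \<open>3\<close> in each direction.
\<close>

lemma open_box_subdivide:
  fixes \<delta> \<delta>' :: "real ^ 'n::{finite,linorder}"
  assumes B: "open_box_with_sides B l" and l\<delta>: "\<And>i. l $ i \<le> \<delta> $ i"
    and pos: "\<And>i. 0 < \<delta>' $ i" and anti: "\<And>i j. i \<le> j \<Longrightarrow> \<delta>' $ j \<le> \<delta>' $ i"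
  obtains C where "finite C" "real (card C) \<le> (\<Prod>i\<in>UNIV. 3 * max 1 (\<delta> $ i / \<delta>' $ i))"
    "box_cover B \<delta>' C"
proof -
  obtain c f where f: "orthogonal_transformation f" and Beq: "B = (\<lambda>x. c + f x) ` box 0 l"
    using B unfolding open_box_with_sides_def by blast
  have lpos: "0 < l $ i" for i
    using B unfolding open_box_with_sides_def by blast
  have lanti: "l $ j \<le> l $ i" if "i \<le> j" for i j
    using B that unfolding open_box_with_sides_def by blast
  define s :: "(real, 'n) vec" where "s = (\<chi> i. min (l $ i) (\<delta>' $ i))"
  have spos: "0 < s $ i" for i
    using lpos pos by (simp add: s_def)
  have santi: "s $ j \<le> s $ i" if "i \<le> j" for i j
    using lanti[OF that] anti[OF that] by (auto simp: s_def)
  define K where "K = (\<lambda>i. {k::nat. real k < 2 * l $ i / s $ i})"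
  define v :: "('n \<Rightarrow> nat) \<Rightarrow> (real, 'n) vec" where "v = (\<lambda>k. \<chi> i. real (k i) * s $ i / 2)"
  define Q where "Q = (\<lambda>k. (\<lambda>x. (c + f (v k)) + f x) ` box 0 s)"
  define C where "C = Q ` (PiE UNIV K)"
  have Ksub: "K i \<subseteq> {..<nat \<lceil>2 * l $ i / s $ i\<rceil>}" for i
    unfolding K_def by (auto simp: less_ceiling_iff zless_nat_eq_int_zless)
  have finK: "finite (K i)" for i
    using Ksub finite_subset by blast
  have cardK: "real (card (K i)) \<le> 3 * max 1 (\<delta> $ i / \<delta>' $ i)" for i
  proof -
    have ls: "l $ i / s $ i \<ge> 1"
      using lpos spos by (simp add: s_def)
    have "card (K i) \<le> nat \<lceil>2 * l $ i / s $ i\<rceil>"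
      using card_mono[OF _ Ksub, of i] by simp
    hence "real (card (K i)) \<le> real (nat \<lceil>2 * l $ i / s $ i\<rceil>)"
      by simp
    also have "\<dots> \<le> 2 * l $ i / s $ i + 1"
      using ls by (simp add: of_nat_ceiling)
    also have "\<dots> \<le> 3 * (l $ i / s $ i)"
      using ls by simp
    also have "l $ i / s $ i = max 1 (l $ i / \<delta>' $ i)"
      using lpos[of i] pos[of i] by (auto simp: s_def min_def max_def field_simps)
    also have "\<dots> \<le> max 1 (\<delta> $ i / \<delta>' $ i)"
      using l\<delta>[of i] pos[of i] by (intro max.mono order_refl divide_right_mono) auto
    finally show ?thesis by simp
  qed
  have finPi: "finite (PiE UNIV K)"
    using finK by (intro finite_PiE) auto
  have "card C \<le> card (PiE UNIV K)"
    unfolding C_def by (rule card_image_le[OF finPi])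
  also have "\<dots> = (\<Prod>i\<in>UNIV. card (K i))"
    by (rule card_PiE) simp
  finally have "real (card C) \<le> real (\<Prod>i\<in>UNIV. card (K i))"
    by (rule of_nat_mono)
  also have "\<dots> \<le> (\<Prod>i\<in>UNIV. 3 * max 1 (\<delta> $ i / \<delta>' $ i))"
    unfolding of_nat_prod by (intro prod_mono conjI cardK) auto
  finally have card: "real (card C) \<le> (\<Prod>i\<in>UNIV. 3 * max 1 (\<delta> $ i / \<delta>' $ i))" .
  have cover: "B \<subseteq> \<Union>C"
  proof
    fix y assume "y \<in> B"
    then obtain x where x: "x \<in> box 0 l" and y: "y = c + f x"
      using Beq by blast
    have x0: "0 < x $ i" and xl: "x $ i < l $ i" for i
      using x by (auto simp: mem_box_cart)
    define k where "k = (\<lambda>i. nat (\<lceil>2 * x $ i / s $ i\<rceil> - 1))"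
    have k: "real (k i) < 2 * x $ i / s $ i" "2 * x $ i / s $ i \<le> real (k i) + 1" for i
    proof -
      have "0 < 2 * x $ i / s $ i"
        using x0 spos by simp
      hence "1 \<le> \<lceil>2 * x $ i / s $ i\<rceil>"
        by (simp add: one_le_ceiling)
      hence "real (k i) = of_int \<lceil>2 * x $ i / s $ i\<rceil> - 1"
        by (simp add: k_def)
      thus "real (k i) < 2 * x $ i / s $ i" "2 * x $ i / s $ i \<le> real (k i) + 1"
        using ceiling_correct[of "2 * x $ i / s $ i"] by auto
    qed
    have "k i \<in> K i" for i
    proof -
      have "2 * x $ i / s $ i \<le> 2 * l $ i / s $ i"
        using xl[of i] spos[of i] by (intro divide_right_mono) auto
      thus ?thesis using k(1)[of i] by (simp add: K_def)
    qed
    moreover have "x - v k \<in> box 0 s"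
    proof -
      have "0 < x $ i - real (k i) * s $ i / 2 \<and> x $ i - real (k i) * s $ i / 2 < s $ i" for i
        using k[of i] spos[of i] by (auto simp: field_simps)
      thus ?thesis by (simp add: mem_box_cart v_def)
    qed
    moreover have "y = (c + f (v k)) + f (x - v k)"
      using f by (simp add: y orthogonal_transformation_def linear_diff)
    ultimately show "y \<in> \<Union>C"
      unfolding C_def Q_def by blast
  qed
  have "open_box_with_sides (Q k) s" for k
    unfolding open_box_with_sides_def Q_def using spos santi f by blast
  moreover have "s $ i \<le> \<delta>' $ i" for i
    by (simp add: s_def)
  ultimately have "\<exists>l. open_box_with_sides (Q k) l \<and> (\<forall>i. l $ i \<le> \<delta>' $ i)" for k
    by blast
  hence "box_cover B \<delta>' C"
    using cover by (auto simp: box_cover_def C_def)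
  moreover have "finite C"
    using finPi by (simp add: C_def)
  ultimately show thesis
    using card that by simp
qed

lemma box_cover_subdivide:
  fixes \<delta> \<delta>' :: "real ^ 'n::{finite,linorder}"
  assumes C: "finite C" "box_cover F \<delta> C"
    and pos: "\<And>i. 0 < \<delta>' $ i" and anti: "\<And>i j. i \<le> j \<Longrightarrow> \<delta>' $ j \<le> \<delta>' $ i"
  obtains C' where "finite C'" "box_cover F \<delta>' C'"
    "real (card C') \<le> real (card C) * (\<Prod>i\<in>UNIV. 3 * max 1 (\<delta> $ i / \<delta>' $ i))"
proof -
  let ?P = "\<Prod>i\<in>UNIV. 3 * max 1 (\<delta> $ i / \<delta>' $ i)"
  have "\<exists>D. finite D \<and> real (card D) \<le> ?P \<and> box_cover B \<delta>' D" if "B \<in> C" for B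
  proof -
    have "\<exists>l. open_box_with_sides B l \<and> (\<forall>i. l $ i \<le> \<delta> $ i)"
      using C(2) that unfolding box_cover_def by (elim conjE bspec)
    then obtain l where "open_box_with_sides B l" "\<And>i. l $ i \<le> \<delta> $ i"
      by (elim exE conjE) auto
    then obtain D where "finite D" "real (card D) \<le> ?P" "box_cover B \<delta>' D"
      by (rule open_box_subdivide[OF _ _ pos anti])
    thus ?thesis by blast
  qed
  then obtain D where D: "\<And>B. B \<in> C \<Longrightarrow> finite (D B)" "\<And>B. B \<in> C \<Longrightarrow> real (card (D B)) \<le> ?P"
    "\<And>B. B \<in> C \<Longrightarrow> box_cover B \<delta>' (D B)"
    by metis
  have "box_cover F \<delta>' (\<Union>(D ` C))"
    unfolding box_cover_def
  proof (intro conjI ballI)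
    show "F \<subseteq> \<Union>(\<Union>(D ` C))"
    proof
      fix x assume "x \<in> F"
      then obtain B where "B \<in> C" "x \<in> B"
        using C(2) by (auto simp: box_cover_def)
      moreover have "B \<subseteq> \<Union>(D B)"
        using D(3)[OF \<open>B \<in> C\<close>] by (simp add: box_cover_def)
      ultimately show "x \<in> \<Union>(\<Union>(D ` C))" by blast
    qed
  next
    fix E assume "E \<in> \<Union>(D ` C)"
    then obtain B where "B \<in> C" "E \<in> D B" by blast
    thus "\<exists>l. open_box_with_sides E l \<and> (\<forall>i. l $ i \<le> \<delta>' $ i)"
      using D(3)[of B] by (simp add: box_cover_def)
  qed
  moreover have "real (card (\<Union>(D ` C))) \<le> real (card C) * ?P"
  proof -
    have "real (card (\<Union>(D ` C))) \<le> real (\<Sum>B\<in>C. card (D B))"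
      using card_UN_le[OF C(1)] of_nat_le_iff by blast
    also have "\<dots> \<le> (\<Sum>B\<in>C. ?P)"
      unfolding of_nat_sum by (intro sum_mono D)
    finally show ?thesis by simp
  qed
  moreover have "finite (\<Union>(D ` C))"
    using C(1) D(1) by simp
  ultimately show thesis
    using that by simp
qed

lemma finite_box_cover_exists:
  fixes F :: "(real ^ 'n::{finite,linorder}) set"
  assumes "bounded F" and pos: "\<And>i. 0 < \<delta> $ i" and anti: "\<And>i j. i \<le> j \<Longrightarrow> \<delta> $ j \<le> \<delta> $ i"
  obtains C where "finite C" "box_cover F \<delta> C"
proof -
  obtain a where a: "F \<subseteq> box (-a) a"
    using bounded_subset_box_symmetric[OF assms(1)] by blast
  define R where "R = 1 + 2 * (\<Sum>i\<in>UNIV. \<bar>a $ i\<bar>)"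
  have R: "2 * \<bar>a $ i\<bar> < R" for i
    using member_le_sum[of i UNIV "\<lambda>i. \<bar>a $ i\<bar>"] by (simp add: R_def)
  define r :: "(real, 'n) vec" where "r = (\<chi> i. R)"
  define B where "B = (\<lambda>x. - a + id x) ` box 0 r"
  have "0 < R"
    using R[of undefined] by (smt (verit) abs_ge_zero)
  moreover have "\<exists>c f. orthogonal_transformation f \<and> B = (\<lambda>x. c + f x) ` box 0 r"
    unfolding B_def id_def using orthogonal_transformation_id by blast
  ultimately have "open_box_with_sides B r"
    by (simp add: open_box_with_sides_def r_def)
  moreover have "F \<subseteq> B"
  proof
    fix x assume "x \<in> F"
    hence "x \<in> box (-a) a" using a by blast
    hence x: "- a $ i < x $ i" "x $ i < a $ i" for i
      by (auto simp: mem_box_cart)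
    have "0 < x $ i + a $ i \<and> x $ i + a $ i < R" for i
      using x[of i] R[of i] by linarith
    hence "x + a \<in> box 0 r"
      by (simp add: mem_box_cart r_def)
    thus "x \<in> B"
      unfolding B_def by (intro image_eqI[of _ _ "x + a"]) auto
  qed
  ultimately have "box_cover F r {B}"
    unfolding box_cover_def by auto
  then obtain C where "finite C" "box_cover F \<delta> C"
    by (rule box_cover_subdivide[OF _ _ pos anti, rotated]) simp_all
  thus thesis by (rule that)
qed

lemma box_number_le_card:
  assumes "finite C" "box_cover F \<delta> C"
  shows "box_number F \<delta> \<le> card C"
  unfolding box_number_def using assms by (intro Least_le) blast

lemma box_number_attained:
  fixes F :: "(real ^ 'n::{finite,linorder}) set"
  assumes "bounded F" and pos: "\<And>i. 0 < \<delta> $ i" and anti: "\<And>i j. i \<le> j \<Longrightarrow> \<delta> $ j \<le> \<delta> $ i"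
  obtains C where "finite C" "box_cover F \<delta> C" "card C = box_number F \<delta>"
proof -
  let ?Q = "\<lambda>k. \<exists>C. finite C \<and> card C = k \<and> box_cover F \<delta> C"
  have "\<exists>k. ?Q k"
    using finite_box_cover_exists[OF assms] by metis
  hence "?Q (LEAST k. ?Q k)"
    by (rule LeastI_ex)
  thus thesis
    using that unfolding box_number_def by metis
qed

lemma box_number_pos:
  fixes F :: "(real ^ 'n::{finite,linorder}) set"
  assumes "F \<noteq> {}" "bounded F" "\<And>i. 0 < \<delta> $ i" "\<And>i j. i \<le> j \<Longrightarrow> \<delta> $ j \<le> \<delta> $ i"
  shows "0 < box_number F \<delta>"
proof -
  obtain C where C: "finite C" "box_cover F \<delta> C" "card C = box_number F \<delta>"
    using box_number_attained[OF assms(2-4)] by metis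
  have "C \<noteq> {}"
    using C(2) assms(1) by (auto simp: box_cover_def)
  thus ?thesis
    using C by (metis card_gt_0_iff)
qed

lemma box_number_antimono:
  fixes F :: "(real ^ 'n::{finite,linorder}) set"
  assumes "bounded F" "\<And>i. 0 < \<delta> $ i" "\<And>i j. i \<le> j \<Longrightarrow> \<delta> $ j \<le> \<delta> $ i"
    and "\<And>i. \<delta> $ i \<le> \<delta>' $ i"
  shows "box_number F \<delta>' \<le> box_number F \<delta>"
proof -
  obtain C where C: "finite C" "box_cover F \<delta> C" "card C = box_number F \<delta>"
    using box_number_attained[OF assms(1-3)] by metis
  have "box_cover F \<delta>' C"
    using C(2) assms(4) unfolding box_cover_def by (meson order_trans)
  thus ?thesis
    using box_number_le_card C by metis
qed

lemma box_number_subdivide: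
  fixes F :: "(real ^ 'n::{finite,linorder}) set"
  assumes "bounded F" "\<And>i. 0 < \<delta> $ i" "\<And>i j. i \<le> j \<Longrightarrow> \<delta> $ j \<le> \<delta> $ i"
    and "\<And>i. 0 < \<delta>' $ i" "\<And>i j. i \<le> j \<Longrightarrow> \<delta>' $ j \<le> \<delta>' $ i"
  shows "real (box_number F \<delta>') \<le> real (box_number F \<delta>) * (\<Prod>i\<in>UNIV. 3 * max 1 (\<delta> $ i / \<delta>' $ i))"
proof -
  obtain C where C: "finite C" "box_cover F \<delta> C" "card C = box_number F \<delta>"
    using box_number_attained[OF assms(1-3)] by metis
  obtain C' where C': "finite C'" "box_cover F \<delta>' C'"
    "real (card C') \<le> real (card C) * (\<Prod>i\<in>UNIV. 3 * max 1 (\<delta> $ i / \<delta>' $ i))"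
    using box_cover_subdivide[OF C(1,2) assms(4,5)] by metis
  thus ?thesis
    using box_number_le_card[OF C'(1,2)] C(3) by simp
qed

section \<open>Exponential scales\<close>

lemma exp_scale_pos: "0 < exp_scale t a $ i"
  by (simp add: exp_scale_def)

lemma exp_scale_antimono:
  assumes "0 \<le> t" "a $ i \<le> a $ j"
  shows "exp_scale t a $ j \<le> exp_scale t a $ i"
  using assms by (simp add: exp_scale_def mult_left_mono)

lemma vec_powr_exp_scale: "vec_powr (exp_scale t a) \<alpha> = exp (- t * (\<alpha> \<bullet> a))"
proof -
  have "vec_powr (exp_scale t a) \<alpha> = (\<Prod>i\<in>UNIV. exp (- t * (\<alpha> $ i * a $ i)))"
    unfolding vec_powr_def by (intro prod.cong) (auto simp: exp_scale_def powr_def)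
  also have "\<dots> = exp (- t * (\<alpha> \<bullet> a))"
    by (simp add: exp_sum[symmetric] inner_vec_def sum_distrib_left sum_negf)
  finally show ?thesis .
qed

text \<open>
  Each of the \<open>n\<close> factors in the subdivision bound is at most \<open>3 e\<^sup>t\<^sup>e\<close> here. This is the form of
  the Lipschitz bound that transfers estimates from one ray to another.
\<close>

lemma ln_box_number_exp_scale_le:
  fixes F :: "(real ^ 'n::{finite,linorder}) set"
  assumes F: "F \<noteq> {}" "bounded F" and t: "0 \<le> t"
    and mono: "\<And>i j. i \<le> j \<Longrightarrow> a $ i \<le> a $ j" "\<And>i j. i \<le> j \<Longrightarrow> b $ i \<le> b $ j"
    and ab: "\<And>i. a $ i \<le> b $ i + e" and e: "0 \<le> e"
  shows "ln (real (box_number F (exp_scale t a)))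
      \<le> ln (real (box_number F (exp_scale t b))) + real CARD('n) * (ln 3 + t * e)"
proof -
  let ?Na = "box_number F (exp_scale t a)" and ?Nb = "box_number F (exp_scale t b)"
  have anti: "exp_scale t a $ j \<le> exp_scale t a $ i" "exp_scale t b $ j \<le> exp_scale t b $ i"
    if "i \<le> j" for i j
    using mono[OF that] t by (auto intro: exp_scale_antimono)
  have pos: "0 < ?Na" "0 < ?Nb"
    using box_number_pos[OF F] anti by (auto simp: exp_scale_pos)
  have "(\<Prod>i\<in>UNIV. 3 * max 1 (exp_scale t b $ i / exp_scale t a $ i))
      \<le> (\<Prod>i\<in>(UNIV :: 'n set). 3 * exp (t * e))"
  proof (intro prod_mono conjI)
    fix i :: 'n
    have "exp_scale t b $ i / exp_scale t a $ i = exp (t * (a $ i - b $ i))"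
      by (simp add: exp_scale_def exp_diff[symmetric] algebra_simps)
    also have "\<dots> \<le> exp (t * e)"
      using ab[of i] t by (auto intro!: mult_left_mono)
    finally show "3 * max 1 (exp_scale t b $ i / exp_scale t a $ i) \<le> 3 * exp (t * e)"
      using t e by simp
  qed auto
  also have "\<dots> = exp (real CARD('n) * (ln 3 + t * e))"
    by (simp add: exp_of_nat_mult exp_add)
  finally have P: "(\<Prod>i\<in>UNIV. 3 * max 1 (exp_scale t b $ i / exp_scale t a $ i))
      \<le> exp (real CARD('n) * (ln 3 + t * e))" .
  have "real ?Na \<le> real ?Nb * (\<Prod>i\<in>UNIV. 3 * max 1 (exp_scale t b $ i / exp_scale t a $ i))"
    by (rule box_number_subdivide[OF F(2)]) (auto simp: exp_scale_pos anti)
  also have "\<dots> \<le> real ?Nb * exp (real CARD('n) * (ln 3 + t * e))"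
    using P by (intro mult_left_mono) auto
  finally have "ln (real ?Na) \<le> ln (real ?Nb * exp (real CARD('n) * (ln 3 + t * e)))"
    using pos by (subst ln_le_cancel_iff) auto
  also have "\<dots> = ln (real ?Nb) + real CARD('n) * (ln 3 + t * e)"
    using pos by (simp add: ln_mult)
  finally show ?thesis .
qed

lemma eventually_small_scales:
  "eventually P small_scales \<longleftrightarrow> (\<exists>e>0. \<forall>\<delta>\<in>\<Delta>. \<delta> $ first_index < e \<longrightarrow> P \<delta>)"
proof
  assume "eventually P small_scales"
  then obtain Q where Q: "eventually Q (at_right (0::real))"
    "\<And>\<delta>. Q (\<delta> $ first_index) \<Longrightarrow> \<delta> \<in> \<Delta> \<Longrightarrow> P \<delta>"
    unfolding small_scales_def eventually_inf_principal eventually_filtercomap by blast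
  obtain e where "e > 0" "\<And>y. 0 < y \<Longrightarrow> y < e \<Longrightarrow> Q y"
    using Q(1) unfolding eventually_at_right_field by auto
  thus "\<exists>e>0. \<forall>\<delta>\<in>\<Delta>. \<delta> $ first_index < e \<longrightarrow> P \<delta>"
    using Q(2) by (intro exI[of _ e]) (auto simp: scale_vectors_def)
next
  assume "\<exists>e>0. \<forall>\<delta>\<in>\<Delta>. \<delta> $ first_index < e \<longrightarrow> P \<delta>"
  then obtain e where e: "e > 0" "\<And>\<delta>. \<delta> \<in> \<Delta> \<Longrightarrow> \<delta> $ first_index < e \<Longrightarrow> P \<delta>"
    by blast
  have "eventually (\<lambda>y. y < e) (at_right (0::real))"
    using e(1) unfolding eventually_at_right_field by blast
  thus "eventually P small_scales"
    unfolding small_scales_def eventually_inf_principal eventually_filtercomap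
    using e(2) by blast
qed

lemma filterlim_exp_scale:
  fixes a :: "(real, 'n::{finite,linorder}) vec"
  assumes "a \<in> \<K>"
  shows "filterlim (\<lambda>t. exp_scale t a) small_scales at_top"
  unfolding filterlim_iff eventually_small_scales
proof (intro allI impI)
  fix P :: "(real, 'n) vec \<Rightarrow> bool"
  assume "\<exists>e>0. \<forall>\<delta>\<in>\<Delta>. \<delta> $ first_index < e \<longrightarrow> P \<delta>"
  then obtain e where e: "e > 0" "\<And>\<delta>. \<delta> \<in> \<Delta> \<Longrightarrow> \<delta> $ first_index < e \<Longrightarrow> P \<delta>"
    by blast
  have a: "0 < a $ i" for i
    using assms by (simp add: exponent_cone_def)
  have mono: "a $ i \<le> a $ j" if "i \<le> j" for i j
    using assms that by (simp add: exponent_cone_def)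
  have "eventually (\<lambda>t. t > max 0 (- ln e / a $ first_index)) at_top"
    by (rule eventually_gt_at_top)
  thus "eventually (\<lambda>t. P (exp_scale t a)) at_top"
  proof eventually_elim
    case (elim t)
    have "exp_scale t a \<in> \<Delta>"
      using elim a mono unfolding scale_vectors_def
      by (auto simp: exp_scale_def mult_left_mono)
    moreover have "- t * a $ first_index < ln e"
      using elim a[of first_index] by (simp add: field_simps)
    hence "exp_scale t a $ first_index < e"
      using e(1) exp_less_cancel_iff[of "- t * a $ first_index" "ln e"] by (simp add: exp_scale_def)
    ultimately show ?case by (rule e(2))
  qed
qed

section \<open>The print lies in the profile body\<close>

lemma lower_print_subset_profile_body:
  fixes F :: "(real ^ 'n::{finite,linorder}) set"
  assumes F: "F \<noteq> {}" "bounded F"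
  shows "lower_print F \<subseteq> profile_body F"
proof
  fix \<alpha> assume \<alpha>: "\<alpha> \<in> lower_print F"
  hence nonneg: "\<alpha> \<in> nonneg_orthant"
    and "0 < Liminf small_scales (\<lambda>\<delta>. ereal (real (box_number F \<delta>) * vec_powr \<delta> \<alpha>))"
    by (auto simp: lower_print_def)
  then obtain c where c0: "0 < ereal c" and
    cL: "ereal c < Liminf small_scales (\<lambda>\<delta>. ereal (real (box_number F \<delta>) * vec_powr \<delta> \<alpha>))"
    using ereal_dense2 by blast
  have c: "0 < c"
    using c0 by simp
  have ev: "eventually (\<lambda>\<delta>. c < real (box_number F \<delta>) * vec_powr \<delta> \<alpha>) small_scales"
    using less_LiminfD[OF cL] by simp
  have "ereal (\<alpha> \<bullet> a) \<le> lower_ecc_profile F a" if a: "a \<in> \<K>" for a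
    unfolding lower_ecc_profile_def le_Liminf_iff
  proof (intro allI impI)
    fix y assume y: "y < ereal (\<alpha> \<bullet> a)"
    have mono: "a $ i \<le> a $ j" if "i \<le> j" for i j
      using a that by (simp add: exponent_cone_def)
    have "((\<lambda>t. \<alpha> \<bullet> a + ln c * inverse t) \<longlongrightarrow> \<alpha> \<bullet> a + ln c * 0) at_top"
      by (intro tendsto_intros tendsto_inverse_0_at_top filterlim_ident)
    hence "((\<lambda>t. ereal (\<alpha> \<bullet> a + ln c * inverse t)) \<longlongrightarrow> ereal (\<alpha> \<bullet> a)) at_top"
      by simp
    hence "eventually (\<lambda>t. y < ereal (\<alpha> \<bullet> a + ln c * inverse t)) at_top"
      using y by (rule order_tendstoD)
    moreover have "eventually (\<lambda>t. c < real (box_number F (exp_scale t a))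
        * vec_powr (exp_scale t a) \<alpha>) at_top"
      by (rule eventually_compose_filterlim[OF ev filterlim_exp_scale[OF a]])
    ultimately show "eventually (\<lambda>t. y < ereal (1 / t * ln (real (box_number F (exp_scale t a))))) at_top"
      using eventually_gt_at_top[of 0]
    proof eventually_elim
      case (elim t)
      have N: "0 < box_number F (exp_scale t a)"
        using elim mono by (intro box_number_pos[OF F] exp_scale_pos exp_scale_antimono) auto
      have "ln c \<le> ln (real (box_number F (exp_scale t a)) * exp (- t * (\<alpha> \<bullet> a)))"
        using elim(2) c N by (simp add: vec_powr_exp_scale)
      also have "\<dots> = ln (real (box_number F (exp_scale t a))) - t * (\<alpha> \<bullet> a)"
        using N by (simp add: ln_mult)
      finally have "(\<alpha> \<bullet> a) * t + ln c \<le> ln (real (box_number F (exp_scale t a)))"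
        by (simp add: mult.commute)
      hence "((\<alpha> \<bullet> a) * t + ln c) / t \<le> ln (real (box_number F (exp_scale t a))) / t"
        using elim(3) by (intro divide_right_mono) auto
      moreover have "((\<alpha> \<bullet> a) * t + ln c) / t = \<alpha> \<bullet> a + ln c * inverse t"
        using elim(3) by (simp add: field_simps)
      ultimately have "\<alpha> \<bullet> a + ln c * inverse t \<le> 1 / t * ln (real (box_number F (exp_scale t a)))"
        by simp
      thus ?case
        by (intro less_le_trans[OF elim(1)]) simp
    qed
  qed
  thus "\<alpha> \<in> profile_body F"
    using nonneg by (simp add: profile_body_def)
qed

section \<open>Uniformity over all directions\<close>

lemma profile_body_nonneg:
  assumes "\<alpha> \<in> profile_body F"
  shows "0 \<le> \<alpha> $ i"
proof -
  have "(\<chi> i. 1) \<in> \<K>"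
    by (simp add: exponent_cone_def)
  thus ?thesis
    using assms unfolding profile_body_def nonneg_orthant_def by blast
qed

text \<open>
  The directions, normalised by \<open>b\<^sub>m = 1\<close>, lie in a compact set that reaches the boundary of
  the cone of exponents. The hypothesis on \<open>\<alpha>\<close> is used only on finitely many rays; these
  lie in the open cone because the centres of an \<open>\<epsilon>\<close>-net are shifted by \<open>\<epsilon>\<close> in every coordinate, which
  at the same time makes the approximating direction dominate \<open>b\<close>.
\<close>

lemma profile_body_uniform_bound:
  fixes F :: "(real ^ 'n::{finite,linorder}) set"
  assumes F: "F \<noteq> {}" "bounded F"
    and \<alpha>: "\<alpha> \<in> profile_body F" and m: "0 < \<alpha> $ m" and \<theta>: "0 \<le> \<theta>" "\<theta> < 1"
  shows "\<exists>T. \<forall>t\<ge>T. \<forall>b. (\<forall>i j. i \<le> j \<longrightarrow> b $ i \<le> b $ j) \<longrightarrow>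
      (\<forall>i. 0 \<le> b $ i \<and> b $ i \<le> 1) \<longrightarrow> b $ m = 1 \<longrightarrow>
      1 \<le> real (box_number F (exp_scale t b)) * vec_powr (exp_scale t b) (\<theta> *\<^sub>R \<alpha>)"
proof -
  define n where "n = real CARD('n)"
  have n: "0 \<le> n" by (simp add: n_def)
  \<comment> \<open>The total error per unit of \<open>t\<close> is \<open>(2n + 1) \<epsilon>\<close>, of which \<open>\<epsilon>\<close> is lost on the ray and
      \<open>2n\<epsilon>\<close> in passing to the nearby direction; it is to use up half of the gain.\<close>
  define \<epsilon> where "\<epsilon> = (1 - \<theta>) * \<alpha> $ m / (2 * (2 * n + 1))"
  have \<epsilon>: "0 < \<epsilon>" using m \<theta> n by (simp add: \<epsilon>_def)
  have \<epsilon>_eq: "(2 * n + 1) * \<epsilon> = (1 - \<theta>) * \<alpha> $ m / 2"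
    using n by (simp add: \<epsilon>_def field_simps)
  have nonneg: "0 \<le> \<alpha> $ i" for i
    by (rule profile_body_nonneg[OF \<alpha>])
  define S where "S = {b \<in> cbox 0 (\<chi> i. (1 :: real)). \<forall>i j :: 'n. i \<le> j \<longrightarrow> b $ i \<le> b $ j}"
  have "S = cbox 0 (\<chi> i. (1 :: real)) \<inter> (\<Inter>i. \<Inter>j\<in>{i..}. {b. b $ i \<le> b $ j})"
    unfolding S_def by auto
  also have "compact \<dots>"
    by (intro compact_Int_closed compact_cbox closed_INT ballI closed_Collect_le continuous_intros)
  finally have "compact S" .
  then obtain A where A: "finite A" "A \<subseteq> S" "S \<subseteq> (\<Union>a\<in>A. ball a \<epsilon>)"
  proof (rule compactE_image[of S S "\<lambda>a. ball a \<epsilon>"])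
    show "S \<subseteq> (\<Union>a\<in>S. ball a \<epsilon>)" using \<epsilon> by auto
  qed auto
  define sh where "sh = (\<lambda>a :: (real, 'n) vec. \<chi> i. a $ i + \<epsilon>)"
  have sh_mono: "sh a $ i \<le> sh a $ j" if "a \<in> A" "i \<le> j" for a i j
    using that A(2) by (auto simp: sh_def S_def)
  have sh_K: "sh a \<in> \<K>" if "a \<in> A" for a
  proof -
    have "0 \<le> a $ i" for i
      using that A(2) by (auto simp: S_def mem_box_cart)
    hence "0 < sh a $ i" for i
      using \<epsilon> by (simp add: sh_def add_nonneg_pos)
    thus ?thesis
      using sh_mono[OF that] by (simp add: exponent_cone_def)
  qed
  have "eventually (\<lambda>t. \<alpha> \<bullet> sh a - \<epsilon> < 1 / t * ln (real (box_number F (exp_scale t (sh a))))) at_top"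
    if "a \<in> A" for a
  proof -
    have "ereal (\<alpha> \<bullet> sh a) \<le> lower_ecc_profile F (sh a)"
      using \<alpha> sh_K[OF that] by (simp add: profile_body_def)
    moreover have "ereal (\<alpha> \<bullet> sh a - \<epsilon>) < ereal (\<alpha> \<bullet> sh a)"
      using \<epsilon> by simp
    ultimately have "eventually (\<lambda>t. ereal (\<alpha> \<bullet> sh a - \<epsilon>)
        < ereal (1 / t * ln (real (box_number F (exp_scale t (sh a)))))) at_top"
      unfolding lower_ecc_profile_def by (intro less_LiminfD) (rule less_le_trans)
    thus ?thesis by simp
  qed
  hence "eventually (\<lambda>t. \<forall>a\<in>A. \<alpha> \<bullet> sh a - \<epsilon> <
      1 / t * ln (real (box_number F (exp_scale t (sh a))))) at_top"
    using A(1) by (simp add: eventually_ball_finite_distrib)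
  then obtain T0 where T0: "\<And>t a. T0 \<le> t \<Longrightarrow> a \<in> A \<Longrightarrow> \<alpha> \<bullet> sh a - \<epsilon> <
      1 / t * ln (real (box_number F (exp_scale t (sh a))))"
    unfolding eventually_at_top_linorder by blast
  define T where "T = max (max 1 T0) (n * ln 3 / ((2 * n + 1) * \<epsilon>))"
  show ?thesis
  proof (intro exI[of _ T] allI impI)
    fix t and b :: "(real, 'n) vec"
    assume t: "T \<le> t" and "\<forall>i j. i \<le> j \<longrightarrow> b $ i \<le> b $ j"
      and "\<forall>i. 0 \<le> b $ i \<and> b $ i \<le> 1" and bm: "b $ m = 1"
    then have mono: "b $ i \<le> b $ j" if "i \<le> j" for i j
      using that by blast
    have b01: "0 \<le> b $ i \<and> b $ i \<le> 1" for i
      using \<open>\<forall>i. 0 \<le> b $ i \<and> b $ i \<le> 1\<close> by blast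
    let ?N = "box_number F (exp_scale t b)"
    have tpos: "0 < t" and "T0 \<le> t" and tn: "n * ln 3 / ((2 * n + 1) * \<epsilon>) \<le> t"
      using t by (auto simp: T_def)
    have "b \<in> S"
      using mono b01 by (simp add: S_def mem_box_cart)
    then obtain a where a: "a \<in> A" "dist a b < \<epsilon>"
      using A(3) by auto
    have close: "\<bar>a $ i - b $ i\<bar> < \<epsilon>" for i
      using a(2) component_le_norm_cart[of "a - b" i] by (simp add: dist_norm)
    have upper: "b $ i \<le> sh a $ i" and lower: "sh a $ i \<le> b $ i + 2 * \<epsilon>" for i
      using close[of i] by (auto simp: sh_def)
    have N: "0 < ?N"
      using tpos mono by (intro box_number_pos[OF F] exp_scale_pos exp_scale_antimono) auto
    have "\<alpha> $ m * 1 \<le> \<alpha> $ m * sh a $ m"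
      using upper[of m] bm m by (intro mult_left_mono) auto
    also have "\<dots> \<le> \<alpha> \<bullet> sh a"
      unfolding inner_vec_def inner_real_def
    proof (rule member_le_sum)
      fix i
      have "0 \<le> sh a $ i" using upper[of i] b01[of i] by linarith
      thus "0 \<le> \<alpha> $ i * sh a $ i" using nonneg by simp
    qed auto
    finally have gain: "\<alpha> $ m \<le> \<alpha> \<bullet> sh a" by simp
    have "\<alpha> \<bullet> b \<le> \<alpha> \<bullet> sh a"
      unfolding inner_vec_def inner_real_def by (intro sum_mono mult_left_mono upper nonneg)
    hence "\<theta> * t * (\<alpha> \<bullet> b) \<le> \<theta> * t * (\<alpha> \<bullet> sh a)"
      using \<theta> tpos by (intro mult_left_mono) auto
    also have "\<dots> \<le> t * (\<alpha> \<bullet> sh a - \<epsilon>) - n * (ln 3 + t * (2 * \<epsilon>))"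
    proof -
      have "n * ln 3 \<le> t * ((2 * n + 1) * \<epsilon>)"
        using tn n \<epsilon> by (subst (asm) pos_divide_le_eq) auto
      moreover have "(1 - \<theta>) * \<alpha> $ m \<le> (1 - \<theta>) * (\<alpha> \<bullet> sh a)"
        using gain \<theta> by (intro mult_left_mono) auto
      hence "2 * ((2 * n + 1) * \<epsilon>) \<le> (1 - \<theta>) * (\<alpha> \<bullet> sh a)"
        using \<epsilon>_eq by simp
      hence "t * (2 * ((2 * n + 1) * \<epsilon>)) \<le> t * ((1 - \<theta>) * (\<alpha> \<bullet> sh a))"
        using tpos by (intro mult_left_mono) auto
      ultimately show ?thesis by (simp add: algebra_simps)
    qed
    also have "t * (\<alpha> \<bullet> sh a - \<epsilon>) \<le> ln (real (box_number F (exp_scale t (sh a))))"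
      using T0[OF \<open>T0 \<le> t\<close> a(1)] tpos by (simp add: field_simps)
    also have "\<dots> \<le> ln (real ?N) + n * (ln 3 + t * (2 * \<epsilon>))"
      unfolding n_def using tpos \<epsilon> lower mono sh_mono[OF a(1)]
      by (intro ln_box_number_exp_scale_le[OF F]) auto
    finally have "\<theta> * t * (\<alpha> \<bullet> b) \<le> ln (real ?N)" by simp
    hence "exp (\<theta> * t * (\<alpha> \<bullet> b)) \<le> real ?N"
      using N by (subst (asm) ln_ge_iff) auto
    hence "real ?N * exp (- (\<theta> * t * (\<alpha> \<bullet> b)))
        \<ge> exp (\<theta> * t * (\<alpha> \<bullet> b)) * exp (- (\<theta> * t * (\<alpha> \<bullet> b)))"
      by (rule mult_right_mono) simp
    moreover have "vec_powr (exp_scale t b) (\<theta> *\<^sub>R \<alpha>) = exp (- (\<theta> * t * (\<alpha> \<bullet> b)))"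
      by (simp add: vec_powr_exp_scale mult.left_commute[of t] mult.assoc)
    ultimately show "1 \<le> real ?N * vec_powr (exp_scale t b) (\<theta> *\<^sub>R \<alpha>)"
      unfolding exp_minus_inverse by simp
  qed
qed

text \<open>
  Truncating the scales at the last index \<open>m\<close> with \<open>\<alpha>\<^sub>m > 0\<close> is what allows the ratios
  \<open>log \<delta>\<^sub>i / log \<delta>\<^sub>m\<close> to stay in \<open>[0,1]\<close>. Normalising by the largest \<open>\<bar>log \<delta>\<^sub>i\<bar>\<close>
  would not do, since \<open>\<alpha> \<bullet> b\<close> could then vanish in the limit and leave no gain.
\<close>

lemma scaled_profile_body_in_lower_print:
  fixes F :: "(real ^ 'n::{finite,linorder}) set"
  assumes F: "F \<noteq> {}" "bounded F"
    and \<alpha>: "\<alpha> \<in> profile_body F" and \<theta>: "0 \<le> \<theta>" "\<theta> < 1"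
  shows "\<theta> *\<^sub>R \<alpha> \<in> lower_print F"
proof -
  have nonneg: "0 \<le> \<alpha> $ i" for i
    by (rule profile_body_nonneg[OF \<alpha>])
  have "eventually (\<lambda>\<delta>. 1 \<le> real (box_number F \<delta>) * vec_powr \<delta> (\<theta> *\<^sub>R \<alpha>)) small_scales"
  proof (cases "\<alpha> = 0")
    case True
    have "1 \<le> real (box_number F \<delta>) * vec_powr \<delta> (\<theta> *\<^sub>R \<alpha>)" if "\<delta> \<in> \<Delta>" for \<delta>
    proof -
      have pos: "0 < \<delta> $ i" for i
        using that by (simp add: scale_vectors_def)
      have "0 < box_number F \<delta>"
        using that by (intro box_number_pos[OF F]) (auto simp: scale_vectors_def)
      moreover have "vec_powr \<delta> (\<theta> *\<^sub>R \<alpha>) = 1"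
        using pos by (simp add: vec_powr_def True less_imp_neq[THEN not_sym])
      ultimately show ?thesis by simp
    qed
    thus ?thesis
      unfolding eventually_small_scales by (intro exI[of _ 1]) auto
  next
    case False
    define m where "m = Max {i. \<alpha> $ i \<noteq> 0}"
    have "{i. \<alpha> $ i \<noteq> 0} \<noteq> {}"
      using False by (auto simp: vec_eq_iff)
    hence "\<alpha> $ m \<noteq> 0"
      using Max_in[of "{i. \<alpha> $ i \<noteq> 0}"] by (simp add: m_def)
    hence m: "0 < \<alpha> $ m"
      using nonneg[of m] by simp
    have beyond: "\<alpha> $ i = 0" if "m < i" for i
    proof (rule ccontr)
      assume "\<alpha> $ i \<noteq> 0"
      hence "i \<le> m"
        unfolding m_def by (intro Max_ge) auto
      with that show False by simp
    qed
    obtain T where T: "\<forall>t\<ge>T. \<forall>b. (\<forall>i j. i \<le> j \<longrightarrow> b $ i \<le> b $ j) \<longrightarrow>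
      (\<forall>i. 0 \<le> b $ i \<and> b $ i \<le> 1) \<longrightarrow> b $ m = 1 \<longrightarrow>
      1 \<le> real (box_number F (exp_scale t b)) * vec_powr (exp_scale t b) (\<theta> *\<^sub>R \<alpha>)"
      using profile_body_uniform_bound[OF F \<alpha> m \<theta>] by (elim exE)
    have "1 \<le> real (box_number F \<delta>) * vec_powr \<delta> (\<theta> *\<^sub>R \<alpha>)"
      if \<delta>: "\<delta> \<in> \<Delta>" and small: "\<delta> $ first_index < exp (- T)" for \<delta>
    proof -
      have pos: "0 < \<delta> $ i" and lt1: "\<delta> $ i < 1" for i
        using \<delta> by (auto simp: scale_vectors_def)
      have anti: "\<delta> $ j \<le> \<delta> $ i" if "i \<le> j" for i j
        using \<delta> that by (simp add: scale_vectors_def)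
      define t where "t = - ln (\<delta> $ m)"
      define b :: "(real, 'n) vec" where "b = (\<chi> i. - ln (\<delta> $ (min i m)) / t)"
      have tpos: "0 < t"
        using pos lt1 by (simp add: t_def)
      have "\<delta> $ m \<le> \<delta> $ first_index"
        by (rule anti) (simp add: first_index_def)
      hence "\<delta> $ m \<le> exp (- T)"
        using small by simp
      hence "T \<le> t"
        using pos[of m] ln_le_cancel_iff[of "\<delta> $ m" "exp (- T)"] by (simp add: t_def)
      have trunc: "exp_scale t b $ i = \<delta> $ (min i m)" for i
        using tpos pos by (simp add: exp_scale_def b_def)
      have "b $ i \<le> b $ j" if "i \<le> j" for i j
      proof -
        have "\<delta> $ (min j m) \<le> \<delta> $ (min i m)"
          using that by (intro anti) (auto simp: min_def)
        thus ?thesis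
          using tpos pos by (auto simp: b_def intro!: divide_right_mono)
      qed
      moreover have "0 \<le> b $ i \<and> b $ i \<le> 1" for i
      proof -
        have "\<delta> $ m \<le> \<delta> $ (min i m)"
          by (intro anti) simp
        hence "- ln (\<delta> $ (min i m)) \<le> t"
          using pos by (simp add: t_def)
        moreover have "0 \<le> - ln (\<delta> $ (min i m))"
          using pos lt1[of "min i m"] by simp
        ultimately show ?thesis
          using tpos unfolding b_def vec_lambda_beta
          by (intro conjI divide_nonneg_pos) (simp_all only: pos_divide_le_eq mult_1)
      qed
      moreover have "b $ m = 1"
        using tpos by (simp add: b_def t_def)
      ultimately have "1 \<le> real (box_number F (exp_scale t b))
          * vec_powr (exp_scale t b) (\<theta> *\<^sub>R \<alpha>)"
        using T \<open>T \<le> t\<close> by simp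
      also have "vec_powr (exp_scale t b) (\<theta> *\<^sub>R \<alpha>) = vec_powr \<delta> (\<theta> *\<^sub>R \<alpha>)"
        unfolding vec_powr_def
      proof (intro prod.cong refl)
        fix i
        show "exp_scale t b $ i powr (\<theta> *\<^sub>R \<alpha>) $ i = \<delta> $ i powr (\<theta> *\<^sub>R \<alpha>) $ i"
        proof (cases "m < i")
          case True
          thus ?thesis using beyond pos by (simp add: trunc less_imp_neq[THEN not_sym])
        next
          case False
          thus ?thesis by (simp add: trunc min_absorb1 not_less)
        qed
      qed
      also have "real (box_number F (exp_scale t b)) * vec_powr \<delta> (\<theta> *\<^sub>R \<alpha>)
          \<le> real (box_number F \<delta>) * vec_powr \<delta> (\<theta> *\<^sub>R \<alpha>)"
      proof (intro mult_right_mono)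
        have "box_number F (exp_scale t b) \<le> box_number F \<delta>"
          by (rule box_number_antimono[OF F(2)]) (auto simp: trunc pos intro: anti)
        thus "real (box_number F (exp_scale t b)) \<le> real (box_number F \<delta>)" by simp
      qed (auto simp: vec_powr_def intro: prod_nonneg)
      finally show ?thesis .
    qed
    thus ?thesis
      unfolding eventually_small_scales by (intro exI[of _ "exp (- T)"]) auto
  qed
  hence "1 \<le> Liminf small_scales (\<lambda>\<delta>. ereal (real (box_number F \<delta>) * vec_powr \<delta> (\<theta> *\<^sub>R \<alpha>)))"
    by (intro Liminf_bounded) (simp add: one_ereal_def)
  hence "0 < Liminf small_scales (\<lambda>\<delta>. ereal (real (box_number F \<delta>) * vec_powr \<delta> (\<theta> *\<^sub>R \<alpha>)))"
    by (rule less_le_trans[rotated]) simp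
  moreover have "\<theta> *\<^sub>R \<alpha> \<in> nonneg_orthant"
    using nonneg \<theta> by (simp add: nonneg_orthant_def)
  ultimately show ?thesis
    by (simp add: lower_print_def)
qed

lemma closed_profile_body:
  fixes F :: "(real ^ 'n::{finite,linorder}) set"
  shows "closed (profile_body F)"
proof -
  have "closed {\<alpha> :: (real, 'n) vec. ereal (\<alpha> \<bullet> a) \<le> c}" for a and c :: ereal
    by (intro closed_Collect_le continuous_on_ereal continuous_on_const continuous_on_inner
        continuous_on_id)
  moreover have "nonneg_orthant = (\<Inter>i. {\<alpha> :: (real, 'n) vec. 0 \<le> \<alpha> $ i})"
    by (auto simp: nonneg_orthant_def)
  moreover have "closed (\<Inter>i. {\<alpha> :: (real, 'n) vec. 0 \<le> \<alpha> $ i})"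
    by (intro closed_INT ballI closed_Collect_le continuous_on_const continuous_on_component
        continuous_on_id)
  ultimately show ?thesis
    unfolding profile_body_def Collect_conj_eq Collect_mem_eq
    by (intro closed_INT ballI closed_Int) auto
qed

theorem theorem3p3:
  fixes F :: "(real ^ 'n::{finite,linorder}) set"
  assumes "F \<noteq> {}" and "bounded F"
  shows "lower_print F \<subseteq> profile_body F
    \<and> (\<forall>\<theta>::real. 0 \<le> \<theta> \<and> \<theta> < 1 \<longrightarrow> (\<lambda>\<alpha>. \<theta> *\<^sub>R \<alpha>) ` profile_body F \<subseteq> lower_print F)
    \<and> closure (lower_print F) = profile_body F"
proof (intro conjI allI impI)
  show sub: "lower_print F \<subseteq> profile_body F"
    by (rule lower_print_subset_profile_body[OF assms])
  show "(\<lambda>\<alpha>. \<theta> *\<^sub>R \<alpha>) ` profile_body F \<subseteq> lower_print F" if "0 \<le> \<theta> \<and> \<theta> < 1" for \<theta> :: real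
    using that scaled_profile_body_in_lower_print[OF assms] by blast
  show "closure (lower_print F) = profile_body F"
  proof
    show "closure (lower_print F) \<subseteq> profile_body F"
      using sub closed_profile_body by (rule closure_minimal)
    show "profile_body F \<subseteq> closure (lower_print F)"
    proof
      fix \<alpha> assume \<alpha>: "\<alpha> \<in> profile_body F"
      have "(\<lambda>k. 1 - inverse (real (Suc k))) \<longlonglongrightarrow> 1 - 0"
        by (intro tendsto_diff tendsto_const LIMSEQ_inverse_real_of_nat)
      hence "(\<lambda>k. (1 - inverse (real (Suc k))) *\<^sub>R \<alpha>) \<longlonglongrightarrow> (1 - 0) *\<^sub>R \<alpha>"
        by (rule tendsto_scaleR) (rule tendsto_const)
      moreover have "(1 - inverse (real (Suc k))) *\<^sub>R \<alpha> \<in> lower_print F" for k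
        by (rule scaled_profile_body_in_lower_print[OF assms \<alpha>]) (auto simp: field_simps)
      ultimately show "\<alpha> \<in> closure (lower_print F)"
        unfolding closure_sequential
        by (intro exI[of _ "\<lambda>k. (1 - inverse (real (Suc k))) *\<^sub>R \<alpha>"]) simp
    qed
  qed
qed

end
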